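(* Let $\ell\in\frac12\mathbb{N}$ and let $W$ be the $(2\ell+1)\times(2\ell+1)$ matrix weight defined in the context. Then $W$ has the LDU-decomposition $$W(x)=\sqrt{1-x^2}\,L(x)\,T(x)\,L(x)^t,\qquad x\in[-1,1],$$ where $L\colon[-1,1]\to M_{2\ell+1}(\mathbb{C})$ is the unipotent lower triangular matrix-valued function $$L(x)_{mk}=\begin{cases}0,&k>m,\\[2pt] \dfrac{m!\,(2k+1)!}{(m+k+1)!\,k!}\,C^{(k+1)}_{m-k}(x),&k\le m,\end{cases}$$ and $T\colon[-1,1]\to M_{2\ell+1}(\mathbb{C})$ is the diagonal matrix-valued function with $$T(x)_{kk}=c_k(\ell)\,(1-x^2)^k,\qquad c_k(\ell)=\frac{4^k(k!)^4(2k+1)}{((2k+1)!)^2}\,\frac{(2\ell+k+1)!\,(2\ell-k)!}{((2\ell)!)^2}.$$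
   Context: $\mathbb{N}=\{0,1,2,\dots\}$; rows and columns of $(2\ell+1)\times(2\ell+1)$ matrices are indexed by $0,1,\dots,2\ell$; $(a)_k=a(a+1)\cdots(a+k-1)$, $(a)_0=1$; $A^t$ is the transpose. $U_r$ is the Chebyshev polynomial of the second kind, $U_r(\cos\theta)=\sin((r+1)\theta)/\sin\theta$. The Gegenbauer polynomial is $C^{(\alpha)}_n(x)=\frac{(2\alpha)_n}{n!}\,{}_2F_1\!\left(-n,n+2\alpha;\alpha+\tfrac12;\tfrac{1-x}{2}\right)$. The weight is, for $0\le m\le n\le 2\ell$, $$W(x)_{n,m}=\sqrt{1-x^2}\sum_{t=0}^m\alpha_t(m,n)\,U_{n+m-2t}(x),$$ $$\alpha_t(m,n)=\frac{2\ell+1}{n+1}\,\frac{(2\ell-m)!\,m!}{(2\ell)!}\,(-1)^{m-t}\,\frac{(n-2\ell)_{m-t}}{(n+2)_{m-t}}\,\frac{(2\ell+2-t)_t}{t!},$$ and $W(x)_{n,m}=W(x)_{m,n}$ for $n<m$. *)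

theory Defs
  imports "HOL-Analysis.Analysis" "Jordan_Normal_Form.Matrix"
begin

text \<open>The Chebyshev polynomial of the second kind, given by its trigonometric characterization;
  the lemma after the definition shows that exactly one polynomial satisfies it.\<close>

definition chebyshev_U :: "nat \<Rightarrow> real poly" where
  "chebyshev_U r = (THE p. \<forall>\<theta>. sin \<theta> \<noteq> 0 \<longrightarrow>
     poly p (cos \<theta>) = sin ((real r + 1) * \<theta>) / sin \<theta>)"

lemma chebyshev_U_ex1:
  "\<exists>!p :: real poly. \<forall>\<theta>. sin \<theta> \<noteq> 0 \<longrightarrow>
     poly p (cos \<theta>) = sin ((real r + 1) * \<theta>) / sin \<theta>"
proof (rule ex_ex1I)
  have "\<exists>p. \<forall>\<theta>::real. poly p (cos \<theta>) * sin \<theta> = sin ((real r + 1) * \<theta>)"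
  proof (induction r rule: less_induct)
    case (less r)
    consider "r = 0" | "r = 1" | s where "r = Suc (Suc s)"
      by (metis One_nat_def not0_implies_Suc)
    then show ?case
    proof cases
      case 1
      then show ?thesis by (intro exI[of _ 1]) simp
    next
      case 2
      then show ?thesis by (intro exI[of _ "[:0, 2:]"]) (simp add: sin_double)
    next
      case (3 s)
      obtain p where p: "poly p (cos \<theta>) * sin \<theta> = sin ((real s + 1) * \<theta>)" for \<theta>
        using less[of s] 3 by auto
      obtain q where q: "poly q (cos \<theta>) * sin \<theta> = sin ((real s + 2) * \<theta>)" for \<theta>
        using less[of "Suc s"] 3 by (auto simp: add.commute)
      have "poly ([:0, 2:] * q - p) (cos \<theta>) * sin \<theta> = sin ((real r + 1) * \<theta>)" for \<theta>
      proof -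
        have "sin ((real s + 3) * \<theta>) + sin ((real s + 1) * \<theta>) = 2 * cos \<theta> * sin ((real s + 2) * \<theta>)"
          using sin_add[of "(real s + 2) * \<theta>" \<theta>] sin_diff[of "(real s + 2) * \<theta>" \<theta>]
          by (simp add: algebra_simps)
        moreover have "real r + 1 = real s + 3" using 3 by simp
        moreover have "poly ([:0, 2:] * q - p) (cos \<theta>) * sin \<theta> =
            2 * cos \<theta> * (poly q (cos \<theta>) * sin \<theta>) - poly p (cos \<theta>) * sin \<theta>"
          by (simp add: algebra_simps)
        ultimately show ?thesis unfolding p q by (simp add: add.commute)
      qed
      then show ?thesis by blast
    qed
  qed
  then obtain p where p: "poly p (cos \<theta>) * sin \<theta> = sin ((real r + 1) * \<theta>)" for \<theta> :: real
    by blast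
  show "\<exists>p. \<forall>\<theta>::real. sin \<theta> \<noteq> 0 \<longrightarrow> poly p (cos \<theta>) = sin ((real r + 1) * \<theta>) / sin \<theta>"
    by (intro exI[of _ p]) (simp add: p[symmetric])
next
  fix p q :: "real poly"
  assume p: "\<forall>\<theta>. sin \<theta> \<noteq> 0 \<longrightarrow> poly p (cos \<theta>) = sin ((real r + 1) * \<theta>) / sin \<theta>"
    and q: "\<forall>\<theta>. sin \<theta> \<noteq> 0 \<longrightarrow> poly q (cos \<theta>) = sin ((real r + 1) * \<theta>) / sin \<theta>"
  have "poly (p - q) x = 0" if "x \<in> {-1<..<1}" for x
  proof -
    have "sin (arccos x) \<noteq> 0" using that by (intro sin_arccos_nonzero) auto
    with p q have "poly p (cos (arccos x)) = poly q (cos (arccos x))" by simp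
    with that show ?thesis by simp
  qed
  then have "{-1<..<1} \<subseteq> {x. poly (p - q) x = 0}" by blast
  moreover have "infinite {-1<..<1::real}" by (simp add: infinite_Ioo)
  ultimately have "infinite {x. poly (p - q) x = 0}" using finite_subset by blast
  then have "p - q = 0" using poly_roots_finite by blast
  then show "p = q" by simp
qed

definition hyp2F1 :: "real \<Rightarrow> real \<Rightarrow> real \<Rightarrow> real \<Rightarrow> real" where
  "hyp2F1 a b c z = eval_fps (fps_hypergeo [a, b] [c] 1) z"

definition gegenbauer :: "real \<Rightarrow> nat \<Rightarrow> real \<Rightarrow> real" where
  "gegenbauer \<alpha> n x = pochhammer (2 * \<alpha>) n / fact n *
     hyp2F1 (- real n) (real n + 2 * \<alpha>) (\<alpha> + 1 / 2) ((1 - x) / 2)"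

text \<open>The parameter \<open>l\<close> is a half-integer; \<open>twice l\<close> is the integer \<open>2 l\<close> as a natural number,
  so that matrices have size \<open>twice l + 1\<close> and are indexed by \<open>0, \<dots>, 2 l\<close>.\<close>

definition twice :: "real \<Rightarrow> nat" where
  "twice l = nat \<lfloor>2 * l\<rfloor>"

definition weight_coeff :: "real \<Rightarrow> nat \<Rightarrow> nat \<Rightarrow> nat \<Rightarrow> real" where
  "weight_coeff l t m n =
     (2 * l + 1) / (real n + 1) * (fact (twice l - m) * fact m / fact (twice l)) *
     (- 1) ^ (m - t) *
     (pochhammer (real n - 2 * l) (m - t) / pochhammer (real n + 2) (m - t)) *
     (pochhammer (2 * l + 2 - real t) t / fact t)"

definition weight_lower :: "real \<Rightarrow> real \<Rightarrow> nat \<Rightarrow> nat \<Rightarrow> real" where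
  "weight_lower l x n m =
     sqrt (1 - x\<^sup>2) * (\<Sum>t = 0..m. weight_coeff l t m n * poly (chebyshev_U (n + m - 2 * t)) x)"

definition weight :: "real \<Rightarrow> real \<Rightarrow> complex mat" where
  "weight l x = mat (twice l + 1) (twice l + 1)
     (\<lambda>(n, m). complex_of_real (if m \<le> n then weight_lower l x n m else weight_lower l x m n))"

definition L_mat :: "real \<Rightarrow> real \<Rightarrow> complex mat" where
  "L_mat l x = mat (twice l + 1) (twice l + 1)
     (\<lambda>(m, k). complex_of_real
       (if k > m then 0
        else fact m * fact (2 * k + 1) / (fact (m + k + 1) * fact k) *
             gegenbauer (real k + 1) (m - k) x))"

definition T_coeff :: "real \<Rightarrow> nat \<Rightarrow> real" where
  "T_coeff l k =
     4 ^ k * fact k ^ 4 * (2 * real k + 1) / (fact (2 * k + 1))\<^sup>2 *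
     (fact (twice l + k + 1) * fact (twice l - k) / (fact (twice l))\<^sup>2)"

definition T_mat :: "real \<Rightarrow> real \<Rightarrow> complex mat" where
  "T_mat l x = mat (twice l + 1) (twice l + 1)
     (\<lambda>(j, k). complex_of_real (if j = k then T_coeff l k * (1 - x\<^sup>2) ^ k else 0))"

definition unipotent_lower_triangular :: "'a :: {zero, one} mat \<Rightarrow> bool" where
  "unipotent_lower_triangular A \<longleftrightarrow>
     square_mat A \<and> upper_triangular (transpose_mat A) \<and> (\<forall>i < dim_row A. A $$ (i, i) = 1)"

end

theory Submission
  imports Defs
begin

text \<open>
  Write \<open>N = 2 l\<close>, \<open>s = sqrt (1 - x\<^sup>2)\<close>, and, for \<open>k \<le> n\<close>,
  \<open>w(n,k) = (2 s)^k k! / (n + k + 1)! * C(n-k)(x)\<close>, where \<open>C(j)\<close> is the Gegenbauer polynomial of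
  degree \<open>j\<close> with parameter \<open>k + 1\<close>. In this normalization the entry \<open>(n, m)\<close> of \<open>L T L\<^sup>t\<close> is
  \<open>n! m! / N!\<^sup>2\<close> times
  \<open>F(n,m) = \<Sum>k. (2 k + 1) (N + k + 1)! (N - k)! w(n,k) w(m,k)\<close>.

  The coefficients of the weight can be written as
  \<open>n! m! / N!\<^sup>2 * (N - m)! (N - n)! * e\<^sub>t\<close>, where \<open>e\<^sub>t\<close> depends on \<open>n\<close> and \<open>m\<close> only
  through \<open>n + m\<close>, as does the index of \<open>U\<close> in the sum over \<open>t\<close>. Passing from \<open>(n + 1, m - 1)\<close> to
  \<open>(n, m)\<close> therefore only rescales the sum and adds one term, \<open>t = m\<close>, which carries \<open>U(n - m)\<close>.
  So the decomposition follows by induction on \<open>m\<close> from the relation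
  \<open>(N - m + 1) F(n,m) - (N - n) F(n+1,m-1) = (N + 1)!\<^sup>2 / (m! (n + 1)!) * U(n - m)\<close>
  (\<open>wave_sum_step\<close>).

  That relation is a telescoping sum over \<open>k\<close>. The partial sums are explicit because a weighted
  two-by-two determinant of the \<open>w\<close>'s with second index (level) \<open>k + 1\<close> equals another one at level \<open>k\<close>
  (\<open>wave_casoratian\<close>), whatever \<open>N\<close> is. The end
  of the telescope vanishes, and its start is, up to factorials, \<open>U(n) U(m) - U(n+1) U(m-1) = U(n - m)\<close>.
  The determinant identity in turn holds since going from level \<open>k\<close> to \<open>k + 1\<close> acts on
  consecutive \<open>w\<close>'s by a two-by-two matrix of determinant proportional to \<open>1 - x\<^sup>2\<close>; this is the pair
  of classical first-order differential relations between neighbouring Gegenbauer polynomials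
  (\<open>gegenbauer_up\<close> and \<open>gegenbauer_down\<close>).
  At \<open>x = 1\<close> and \<open>x = -1\<close> both sides of the theorem vanish, so \<open>|x| < 1\<close> is assumed until the end.
\<close>

section \<open>Gegenbauer polynomials as terminating hypergeometric sums\<close>

text \<open>The coefficient of \<open>z ^ j\<close> with \<open>z = (1 - x) / 2\<close>. The two rising factorials
  \<open>pochhammer (2 a) n\<close> and \<open>pochhammer (n + 2 a) j\<close> of the defining formula are merged into one,
  which makes the comparison of neighbouring degrees a matter of single factors.\<close>

definition geg_coeff :: "real \<Rightarrow> nat \<Rightarrow> nat \<Rightarrow> real" where
  "geg_coeff a n j = pochhammer (2 * a) (n + j) * pochhammer (- real n) j /
     (fact n * fact j * pochhammer (a + 1 / 2) j)"

lemma geg_coeff_eq_0: "n < j \<Longrightarrow> geg_coeff a n j = 0"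
  by (simp add: geg_coeff_def pochhammer_of_nat_eq_0_lemma)

definition geg_poly :: "real \<Rightarrow> nat \<Rightarrow> real poly" where
  "geg_poly a n = (\<Sum>j\<le>n. monom (geg_coeff a n j) j)"

lemma coeff_geg_poly: "coeff (geg_poly a n) j = geg_coeff a n j"
  by (auto simp: geg_poly_def coeff_sum geg_coeff_eq_0)

lemma gegenbauer_eq_poly: "gegenbauer a n x = poly (geg_poly a n) ((1 - x) / 2)"
proof -
  let ?z = "(1 - x) / 2"
  let ?h = "fps_nth (fps_hypergeo [- real n, real n + 2 * a] [a + 1 / 2] 1)"
  have h: "pochhammer (2 * a) n / fact n * ?h j = geg_coeff a n j" for j
    using pochhammer_product'[of "2 * a" n j]
    by (simp add: fps_hypergeo_nth geg_coeff_def add.commute mult_ac)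
  have h0: "?h j = 0" if "n < j" for j
    using that by (simp add: fps_hypergeo_nth pochhammer_of_nat_eq_0_lemma)
  have "hyp2F1 (- real n) (real n + 2 * a) (a + 1 / 2) ?z = (\<Sum>j. ?h j * ?z ^ j)"
    by (simp add: hyp2F1_def eval_fps_def)
  also have "\<dots> = (\<Sum>j\<le>n. ?h j * ?z ^ j)"
    by (rule suminf_finite) (simp_all add: h0 del: fps_hypergeo_nth)
  finally have "gegenbauer a n x = (\<Sum>j\<le>n. (pochhammer (2 * a) n / fact n * ?h j) * ?z ^ j)"
    by (simp add: gegenbauer_def sum_distrib_left mult.assoc)
  also have "\<dots> = poly (geg_poly a n) ?z"
    unfolding h by (simp add: geg_poly_def poly_sum poly_monom)
  finally show ?thesis .
qed

section \<open>Differential relations between neighbouring degrees\<close>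

context
  fixes a :: real
  assumes a_pos: "0 < a"
begin

lemma pochhammer_half_nz: "pochhammer (a + 1 / 2) j \<noteq> 0"
  using pochhammer_pos[of "a + 1 / 2" j] a_pos by simp

lemma half_nz: "a + 1 / 2 + real j \<noteq> 0"
  using a_pos by simp

text \<open>The next three lemmas tie neighbours of a coefficient to it by one common divisor, so that an
  identity between polynomials, read off coefficientwise, becomes an identity between
  polynomials in \<open>n\<close>, \<open>j\<close> and \<open>a\<close> after multiplication by that divisor.\<close>

lemma geg_coeff_Suc:
  "geg_coeff a n (Suc j) * ((real j + 1) * (a + 1 / 2 + real j)) =
     geg_coeff a n j * ((real j - real n) * (2 * a + real n + real j))"
proof -
  define X Y P where "X = pochhammer (2 * a) (n + j)" and "Y = pochhammer (- real n) j"
    and "P = pochhammer (a + 1 / 2) j"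
  have "P \<noteq> 0" unfolding P_def by (rule pochhammer_half_nz)
  moreover note half_nz[of j]
  ultimately show ?thesis
    unfolding geg_coeff_def fact_Suc add_Suc_right pochhammer_Suc of_nat_add
      X_def[symmetric] Y_def[symmetric] P_def[symmetric]
    by (simp add: divide_simps; simp add: algebra_simps)
qed

lemma geg_coeff_Suc_Suc:
  "geg_coeff a (Suc n) (Suc j) * ((real j + 1) * (a + 1 / 2 + real j)) =
     - geg_coeff a n j * ((2 * a + real n + real j) * (2 * a + real n + real j + 1))"
proof -
  define X Y P where "X = pochhammer (2 * a) (n + j)" and "Y = pochhammer (- real n) j"
    and "P = pochhammer (a + 1 / 2) j"
  have Y: "pochhammer (- real (Suc n)) (Suc j) = - (real n + 1) * Y"
    unfolding Y_def pochhammer_rec by simp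
  have "P \<noteq> 0" unfolding P_def by (rule pochhammer_half_nz)
  moreover note half_nz[of j]
  ultimately show ?thesis
    unfolding geg_coeff_def Y
    unfolding fact_Suc add_Suc_right add_Suc pochhammer_Suc of_nat_add of_nat_Suc
      X_def[symmetric] Y_def[symmetric] P_def[symmetric]
    by (simp add: divide_simps; simp add: algebra_simps)
qed

lemma geg_coeff_lower:
  "geg_coeff a n (Suc j) * ((real j + 1) * (a + 1 / 2 + real j)) =
     geg_coeff a (Suc n) j * ((real n + 1 - real j) * (real j - real n))"
proof -
  define X Y P where "X = pochhammer (2 * a) (Suc (n + j))" and "Y = pochhammer (- real n) j"
    and "P = pochhammer (a + 1 / 2) j"
  have "pochhammer (- real (Suc n)) j * (real j - real n - 1) = - (real n + 1) * Y"
    unfolding Y_def using pochhammer_rec[of "- real (Suc n)" j] pochhammer_Suc[of "- real (Suc n)" j]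
    by (simp add: algebra_simps)
  then have Y: "Y = pochhammer (- real (Suc n)) j * (real n + 1 - real j) / (real n + 1)"
    by (simp add: field_simps)
  have "P \<noteq> 0" unfolding P_def by (rule pochhammer_half_nz)
  moreover note half_nz[of j]
  ultimately show ?thesis
    unfolding geg_coeff_def fact_Suc add_Suc_right add_Suc pochhammer_Suc[of "- real n"]
      pochhammer_Suc[of "a + 1 / 2"] X_def[symmetric] Y_def[symmetric] P_def[symmetric]
    unfolding Y
    by (simp add: divide_simps; simp add: algebra_simps)
qed

text \<open>The coefficient form of \<open>d/dx C(n+1) = 2 a C(n)\<close>, with parameters \<open>a\<close> and \<open>a + 1\<close>;
  the remaining factor \<open>-2\<close> comes from \<open>x = 1 - 2 z\<close>.\<close>

lemma geg_coeff_deriv: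
  "4 * a * geg_coeff (a + 1) n j = - (real j + 1) * geg_coeff a (Suc n) (Suc j)"
proof -
  define X Y P where "X = pochhammer (2 * a + 2) (n + j)" and "Y = pochhammer (- real n) j"
    and "P = pochhammer (a + 3 / 2) j"
  have X: "pochhammer (2 * a) (Suc (Suc (n + j))) = 2 * a * (2 * a + 1) * X"
    unfolding X_def pochhammer_rec by (simp add: algebra_simps)
  have Y: "pochhammer (- real (Suc n)) (Suc j) = - (real n + 1) * Y"
    unfolding Y_def pochhammer_rec by simp
  have P: "pochhammer (a + 1 / 2) (Suc j) = (a + 1 / 2) * P"
    unfolding P_def pochhammer_rec by (simp add: algebra_simps)
  have "P \<noteq> 0" unfolding P_def using pochhammer_pos[of "a + 3 / 2" j] a_pos by simp
  moreover have e: "a + 1 + 1 / 2 = a + 3 / 2" "2 * (a + 1) = 2 * a + 2" by simp_all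
  moreover have "a \<noteq> 0" "a + 1 / 2 \<noteq> 0" "2 * a + 1 \<noteq> 0" using a_pos by simp_all
  ultimately show ?thesis
    unfolding geg_coeff_def e X Y P fact_Suc add_Suc_right add_Suc
      X_def[symmetric] Y_def[symmetric] P_def[symmetric]
    by (simp add: divide_simps; simp add: algebra_simps)
qed

lemma pderiv_geg_poly_Suc:
  "pderiv (geg_poly a (Suc n)) = Polynomial.smult (- 4 * a) (geg_poly (a + 1) n)"
proof (rule poly_eqI)
  fix j
  show "coeff (pderiv (geg_poly a (Suc n))) j = coeff (Polynomial.smult (- 4 * a) (geg_poly (a + 1) n)) j"
    using geg_coeff_deriv[of n j] by (simp add: coeff_pderiv coeff_geg_poly algebra_simps)
qed

text \<open>In the variable \<open>x = 1 - 2 z\<close> this is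
  \<open>(1 - x\<^sup>2) C(n)' = (n + 2 a) x C(n) - (n + 1) C(n+1)\<close>: the operator \<open>(1 - x\<^sup>2) d/dx\<close> is
  \<open>-2 z (1 - z) d/dz\<close>. The next lemma is its companion
  \<open>(1 - x\<^sup>2) C(n+1)' = (n + 2 a) C(n) - (n + 1) x C(n+1)\<close>.\<close>

lemma geg_poly_deriv_up:
  "Polynomial.smult (- 2) ([:0, 1, -1:] * pderiv (geg_poly a n)) =
     Polynomial.smult (real n + 2 * a) ([:1, -2:] * geg_poly a n)
       - Polynomial.smult (real n + 1) (geg_poly a (Suc n))"
  (is "?l = ?r")
proof (rule poly_eqI)
  fix j
  show "coeff ?l j = coeff ?r j"
  proof (cases j)
    case 0
    have "pochhammer (2 * a) (Suc n) = pochhammer (2 * a) n * (2 * a + real n)"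
      by (rule pochhammer_Suc)
    then show ?thesis
      using 0 by (simp add: coeff_geg_poly geg_coeff_def divide_simps) (simp add: algebra_simps)
  next
    case (Suc i)
    define e g h u where "e = (real i + 1) * (a + 1 / 2 + real i)" and "g = geg_coeff a n i"
      and "h = geg_coeff a n (Suc i)" and "u = geg_coeff a (Suc n) (Suc i)"
    have "e \<noteq> 0" using half_nz[of i] by (simp add: e_def)
    have l: "coeff ?l j = - 2 * ((real i + 1) * h - real i * g)"
      unfolding Suc g_def h_def
      by (cases i) (simp_all add: coeff_pderiv coeff_geg_poly algebra_simps)
    have r: "coeff ?r j = (real n + 2 * a) * (h - 2 * g) - (real n + 1) * u"
      unfolding Suc g_def h_def u_def by (simp add: coeff_geg_poly algebra_simps)
    have "(coeff ?l j - coeff ?r j) * e = - 2 * ((real i + 1) * (h * e) - real i * (g * e))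
        - ((real n + 2 * a) * (h * e - 2 * (g * e)) - (real n + 1) * (u * e))"
      unfolding l r by (simp add: algebra_simps)
    also have "\<dots> = 0"
      using geg_coeff_Suc[of n i] geg_coeff_Suc_Suc[of n i]
      unfolding e_def[symmetric] g_def[symmetric] h_def[symmetric] u_def[symmetric]
      by (simp only:) (simp add: e_def field_simps)
    finally show ?thesis using \<open>e \<noteq> 0\<close> by simp
  qed
qed

lemma geg_poly_deriv_down:
  "Polynomial.smult (- 2) ([:0, 1, -1:] * pderiv (geg_poly a (Suc n))) =
     Polynomial.smult (real n + 2 * a) (geg_poly a n)
       - Polynomial.smult (real n + 1) ([:1, -2:] * geg_poly a (Suc n))"
  (is "?l = ?r")
proof (rule poly_eqI)
  fix j
  show "coeff ?l j = coeff ?r j"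
  proof (cases j)
    case 0
    have "pochhammer (2 * a) (Suc n) = pochhammer (2 * a) n * (2 * a + real n)"
      by (rule pochhammer_Suc)
    then show ?thesis
      using 0 by (simp add: coeff_geg_poly geg_coeff_def divide_simps) (simp add: algebra_simps)
  next
    case (Suc i)
    define e g h u where "e = (real i + 1) * (a + 1 / 2 + real i)" and "g = geg_coeff a (Suc n) i"
      and "h = geg_coeff a (Suc n) (Suc i)" and "u = geg_coeff a n (Suc i)"
    have "e \<noteq> 0" using half_nz[of i] by (simp add: e_def)
    have l: "coeff ?l j = - 2 * ((real i + 1) * h - real i * g)"
      unfolding Suc g_def h_def
      by (cases i) (simp_all add: coeff_pderiv coeff_geg_poly algebra_simps)
    have r: "coeff ?r j = (real n + 2 * a) * u - (real n + 1) * (h - 2 * g)"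
      unfolding Suc g_def h_def u_def by (simp add: coeff_geg_poly algebra_simps)
    have "(coeff ?l j - coeff ?r j) * e = - 2 * ((real i + 1) * (h * e) - real i * (g * e))
        - ((real n + 2 * a) * (u * e) - (real n + 1) * (h * e - 2 * (g * e)))"
      unfolding l r by (simp add: algebra_simps)
    also have "\<dots> = 0"
      using geg_coeff_Suc[of "Suc n" i] geg_coeff_lower[of n i]
      unfolding e_def[symmetric] g_def[symmetric] h_def[symmetric] u_def[symmetric]
      by (simp only:) (simp add: e_def field_simps)
    finally show ?thesis using \<open>e \<noteq> 0\<close> by simp
  qed
qed

lemma gegenbauer_0: "gegenbauer a 0 x = 1"
  by (simp add: gegenbauer_eq_poly geg_poly_def geg_coeff_def)

lemma gegenbauer_1: "gegenbauer a 1 x = 2 * a * x"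
  using arg_cong[OF geg_poly_deriv_up[of 0], of "\<lambda>p. poly p ((1 - x) / 2)"] gegenbauer_0[of x]
  by (simp add: gegenbauer_eq_poly geg_poly_def geg_coeff_def monom_0 algebra_simps)

text \<open>Replacing the derivative by the polynomial with parameter \<open>a + 1\<close> turns the two differential
  relations into rules that express this polynomial through two consecutive ones with parameter
  \<open>a\<close>: one through the two degrees above, the other through its own degree and the next.\<close>

lemma gegenbauer_up:
  "2 * a * (1 - x\<^sup>2) * gegenbauer (a + 1) n x =
     (real n + 1 + 2 * a) * x * gegenbauer a (Suc n) x - (real n + 2) * gegenbauer a (Suc (Suc n)) x"
  using arg_cong[OF geg_poly_deriv_up[of "Suc n"], of "\<lambda>p. poly p ((1 - x) / 2)"]
  unfolding pderiv_geg_poly_Suc gegenbauer_eq_poly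
  by (simp add: field_simps power2_eq_square)

lemma gegenbauer_down:
  "2 * a * (1 - x\<^sup>2) * gegenbauer (a + 1) n x =
     (real n + 2 * a) * gegenbauer a n x - (real n + 1) * x * gegenbauer a (Suc n) x"
  using arg_cong[OF geg_poly_deriv_down[of n], of "\<lambda>p. poly p ((1 - x) / 2)"]
  unfolding pderiv_geg_poly_Suc gegenbauer_eq_poly
  by (simp add: field_simps power2_eq_square)

lemma gegenbauer_rec:
  "(real n + 2) * gegenbauer a (Suc (Suc n)) x =
     2 * (real n + 1 + a) * x * gegenbauer a (Suc n) x - (real n + 2 * a) * gegenbauer a n x"
  using gegenbauer_up[of x n] gegenbauer_down[of x n] by (simp add: algebra_simps)

end

section \<open>Chebyshev polynomials of the second kind\<close>

lemma chebyshev_U_cos_mult_sin: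
  assumes "sin \<theta> \<noteq> 0"
  shows "poly (chebyshev_U r) (cos \<theta>) * sin \<theta> = sin ((real r + 1) * \<theta>)"
  using theI'[OF chebyshev_U_ex1[of r]] assms unfolding chebyshev_U_def by simp

text \<open>For parameter \<open>1\<close> the three-term recurrence is, after cancelling \<open>n + 2\<close>, the addition
  theorem for \<open>sin ((n + 3) \<theta>) + sin ((n + 1) \<theta>)\<close>.\<close>

lemma gegenbauer_1_cos_mult_sin: "gegenbauer 1 n (cos \<theta>) * sin \<theta> = sin ((real n + 1) * \<theta>)"
proof (induction n rule: induct_nat_012)
  case 0
  then show ?case by (simp add: gegenbauer_0)
next
  case 1
  then show ?case using gegenbauer_1[of 1 "cos \<theta>"] by (simp add: sin_double)
next
  case (ge2 n)
  have "(real n + 2) * gegenbauer 1 (Suc (Suc n)) (cos \<theta>) =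
      (real n + 2) * (2 * cos \<theta> * gegenbauer 1 (Suc n) (cos \<theta>) - gegenbauer 1 n (cos \<theta>))"
    using gegenbauer_rec[of 1 n "cos \<theta>"] by (simp add: algebra_simps)
  then have "gegenbauer 1 (Suc (Suc n)) (cos \<theta>) =
      2 * cos \<theta> * gegenbauer 1 (Suc n) (cos \<theta>) - gegenbauer 1 n (cos \<theta>)"
    by (simp only: mult_cancel_left) (auto simp: add_eq_0_iff)
  then have "gegenbauer 1 (Suc (Suc n)) (cos \<theta>) * sin \<theta> =
      2 * cos \<theta> * (gegenbauer 1 (Suc n) (cos \<theta>) * sin \<theta>) - gegenbauer 1 n (cos \<theta>) * sin \<theta>"
    by (simp only: left_diff_distrib mult.assoc)
  also have "\<dots> = 2 * cos \<theta> * sin ((real n + 2) * \<theta>) - sin ((real n + 1) * \<theta>)"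
    unfolding ge2 by (simp add: add.commute)
  also have "\<dots> = sin ((real n + 3) * \<theta>)"
    using sin_add[of "(real n + 2) * \<theta>" \<theta>] sin_diff[of "(real n + 2) * \<theta>" \<theta>]
    by (simp add: algebra_simps)
  finally show ?case by (simp add: algebra_simps)
qed

lemma obtain_angle:
  fixes x :: real
  assumes "\<bar>x\<bar> < 1"
  obtains \<theta> where "x = cos \<theta>" "sin \<theta> \<noteq> 0"
  using that[of "arccos x"] assms sin_arccos_nonzero[of x] by (simp add: abs_less_iff)

lemma gegenbauer_1_eq_chebyshev_U:
  assumes "\<bar>x\<bar> < 1"
  shows "gegenbauer 1 n x = poly (chebyshev_U n) x"
proof -
  obtain \<theta> where x: "x = cos \<theta>" "sin \<theta> \<noteq> 0" using obtain_angle[OF assms] .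
  have "gegenbauer 1 n x * sin \<theta> = poly (chebyshev_U n) x * sin \<theta>"
    unfolding x(1) gegenbauer_1_cos_mult_sin chebyshev_U_cos_mult_sin[OF x(2)] ..
  with x(2) show ?thesis by simp
qed

text \<open>After multiplication by \<open>sin\<^sup>2 \<theta>\<close> this is the identity \<open>prod\<close> for sines below. It evaluates
  the start of the telescoping sum.\<close>

lemma chebyshev_U_diff:
  assumes "\<bar>x\<bar> < 1" "m < n"
  shows "poly (chebyshev_U n) x * poly (chebyshev_U (Suc m)) x
       - poly (chebyshev_U (Suc n)) x * poly (chebyshev_U m) x
     = poly (chebyshev_U (n - Suc m)) x"
proof -
  obtain \<theta> where x: "x = cos \<theta>" "sin \<theta> \<noteq> 0" using obtain_angle[OF assms(1)] .
  define U where "U r = poly (chebyshev_U r) x" for r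
  have U: "U r * sin \<theta> = sin ((real r + 1) * \<theta>)" for r
    unfolding U_def x(1) by (rule chebyshev_U_cos_mult_sin[OF x(2)])
  have prod: "sin p * sin (q + \<theta>) - sin (p + \<theta>) * sin q = sin \<theta> * sin (p - q)" for p q
    by (simp add: sin_add sin_diff algebra_simps)
  have "(U n * U (Suc m) - U (Suc n) * U m) * (sin \<theta> * sin \<theta>) =
      (U n * sin \<theta>) * (U (Suc m) * sin \<theta>) - (U (Suc n) * sin \<theta>) * (U m * sin \<theta>)"
    by (simp add: algebra_simps)
  also have "\<dots> = sin \<theta> * sin ((real n - real m) * \<theta>)"
    unfolding U using prod[of "(real n + 1) * \<theta>" "(real m + 1) * \<theta>"]
    by (simp add: algebra_simps)
  also have "\<dots> = U (n - Suc m) * (sin \<theta> * sin \<theta>)"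
    using U[of "n - Suc m"] assms(2) by (simp add: of_nat_diff algebra_simps)
  finally show ?thesis using x(2) by (simp add: U_def)
qed


section \<open>Normalized Gegenbauer functions and their level-raising relations\<close>

text \<open>Setting \<open>wave x n k = 0\<close> for \<open>k > n\<close> makes the relations below hold for all \<open>n\<close> and \<open>k\<close>, so that
  sums over \<open>k\<close> end by themselves. In terms of \<open>x = cos \<theta>\<close>, the functions \<open>sin \<theta> * wave x n k\<close>
  solve \<open>u'' + ((n + 1)\<^sup>2 - k (k + 1) / sin\<^sup>2 \<theta>) u = 0\<close>; they are the analogues on the three-sphere of
  spherical Bessel functions of order \<open>k\<close>.\<close>

definition wave :: "real \<Rightarrow> nat \<Rightarrow> nat \<Rightarrow> real" where
  "wave x n k = (2 * sqrt (1 - x\<^sup>2)) ^ k * fact k / fact (n + k + 1) *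
     (if k \<le> n then gegenbauer (real k + 1) (n - k) x else 0)"

lemma wave_eq_0: "n < k \<Longrightarrow> wave x n k = 0"
  by (simp add: wave_def)

lemma wave_0:
  assumes "\<bar>x\<bar> < 1"
  shows "wave x n 0 = poly (chebyshev_U n) x / fact (n + 1)"
  using gegenbauer_1_eq_chebyshev_U[OF assms] by (simp add: wave_def)

lemma sqrt_sq:
  fixes x :: real
  assumes "\<bar>x\<bar> < 1"
  shows "sqrt (1 - x\<^sup>2) * sqrt (1 - x\<^sup>2) = 1 - x\<^sup>2"
  using assms by (simp add: abs_square_le_1)

text \<open>The Gegenbauer relations with \<open>a = k + 1\<close>. Passing from level \<open>k\<close> to \<open>k + 1\<close> at fixed \<open>n\<close> raises the
  parameter and lowers the degree, so \<open>gegenbauer_up\<close> is used for \<open>wave x n (Suc k)\<close> and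
  \<open>gegenbauer_down\<close> for \<open>wave x (Suc n) (Suc k)\<close>. At the edge \<open>k = n\<close> the first relation says that
  the degree one polynomial is \<open>2 (k + 1) x\<close>.\<close>

lemma wave_raise:
  assumes "\<bar>x\<bar> < 1"
  shows "sqrt (1 - x\<^sup>2) * wave x n (Suc k) =
    x * wave x n k - (real n + 1 - real k) * wave x (Suc n) k"
proof -
  define s where "s = sqrt (1 - x\<^sup>2)"
  have s: "s * s = 1 - x\<^sup>2" unfolding s_def by (rule sqrt_sq[OF assms])
  define q :: real where "q = (2 * s) ^ k * fact k / fact (n + k + 2)"
  have f: "fact (n + k + 2) = (real n + real k + 2) * fact (n + k + 1)"
    by simp
  have w1: "wave x n k = q * (real n + real k + 2) *
      (if k \<le> n then gegenbauer (real k + 1) (n - k) x else 0)"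
    unfolding wave_def q_def f s_def[symmetric] by (simp add: divide_simps del: fact_Suc)
  have w2: "wave x (Suc n) k = q * (if k \<le> Suc n then gegenbauer (real k + 1) (Suc n - k) x else 0)"
    unfolding wave_def q_def s_def[symmetric] by (simp del: fact_Suc)
  have w3: "s * wave x n (Suc k) = q * (2 * (real k + 1) * (1 - x\<^sup>2) *
      (if Suc k \<le> n then gegenbauer (real k + 1 + 1) (n - Suc k) x else 0))"
    unfolding wave_def q_def s_def[symmetric]
    unfolding s[symmetric]
    by (simp add: algebra_simps add_divide_distrib fact_Suc[of k] del: fact_Suc)
  consider j where "n = Suc (k + j)" | "n = k" | "n < k"
    by (metis less_imp_Suc_add linorder_neqE_nat)
  then show ?thesis
  proof cases
    case 1
    have up: "2 * (real k + 1) * (1 - x\<^sup>2) * gegenbauer (real k + 1 + 1) j x =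
        (real j + 1 + 2 * (real k + 1)) * x * gegenbauer (real k + 1) (Suc j) x
          - (real j + 2) * gegenbauer (real k + 1) (Suc (Suc j)) x"
      by (rule gegenbauer_up) simp
    have "s * wave x n (Suc k) =
        q * (2 * (real k + 1) * (1 - x\<^sup>2) * gegenbauer (real k + 1 + 1) j x)"
      unfolding w3 using 1 by simp
    then show ?thesis
      unfolding s_def[symmetric] w1 w2 up using 1 by (simp add: Suc_diff_le algebra_simps)
  next
    case 2
    have "gegenbauer (real k + 1) 0 x = 1" by (rule gegenbauer_0) simp
    moreover have "gegenbauer (real k + 1) 1 x = 2 * (real k + 1) * x"
      by (rule gegenbauer_1) simp
    ultimately show ?thesis
      using 2 unfolding s_def[symmetric] w1 w2 w3 by (simp add: algebra_simps)
  next
    case 3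
    then show ?thesis by (cases "k = Suc n") (simp_all add: wave_eq_0)
  qed
qed

lemma wave_raise_Suc:
  assumes "\<bar>x\<bar> < 1"
  shows "sqrt (1 - x\<^sup>2) * (real n + real k + 3) * wave x (Suc n) (Suc k) =
    wave x n k - (real n + 1 - real k) * x * wave x (Suc n) k"
proof (cases "k \<le> n")
  case True
  then obtain j where n: "n = k + j" using le_Suc_ex by blast
  define s where "s = sqrt (1 - x\<^sup>2)"
  have s: "s * s = 1 - x\<^sup>2" unfolding s_def by (rule sqrt_sq[OF assms])
  define q :: real where "q = (2 * s) ^ k * fact k / fact (n + k + 2)"
  have f: "fact (n + k + 2) = (real n + real k + 2) * fact (n + k + 1)"
    "fact (Suc n + Suc k + 1) = (real n + real k + 3) * fact (n + k + 2)"
    by (simp_all add: algebra_simps)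
  have w1: "wave x n k = q * (real n + real k + 2) * gegenbauer (real k + 1) j x"
    unfolding wave_def q_def f s_def[symmetric] by (simp add: divide_simps n del: fact_Suc)
  have w2: "wave x (Suc n) k = q * gegenbauer (real k + 1) (Suc j) x"
    unfolding wave_def q_def s_def[symmetric] by (simp add: n Suc_diff_le del: fact_Suc)
  have w3: "s * (real n + real k + 3) * wave x (Suc n) (Suc k) =
      q * (2 * (real k + 1) * (1 - x\<^sup>2) * gegenbauer (real k + 1 + 1) j x)"
    unfolding wave_def q_def f s_def[symmetric]
    unfolding s[symmetric]
    by (simp add: divide_simps n fact_Suc[of k] del: fact_Suc; simp add: algebra_simps del: fact_Suc)
  have down: "2 * (real k + 1) * (1 - x\<^sup>2) * gegenbauer (real k + 1 + 1) j x =
      (real j + 2 * (real k + 1)) * gegenbauer (real k + 1) j x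
        - (real j + 1) * x * gegenbauer (real k + 1) (Suc j) x"
    by (rule gegenbauer_down) simp
  show ?thesis
    unfolding s_def[symmetric] w1 w2 w3 down by (simp add: n algebra_simps)
next
  case False
  then show ?thesis by (cases "k = Suc n") (simp_all add: wave_eq_0)
qed

text \<open>With \<open>a = w(n,k)\<close>, \<open>b = (n + 1 - k) w(n+1,k)\<close>, and \<open>c\<close>, \<open>d\<close> likewise for \<open>p\<close>, the level-raising
  relations send \<open>(a, b)\<close> to \<open>(x a - b, a - x b)\<close> and \<open>(c, d)\<close> to \<open>(x c - d, c - x d)\<close>, up to the
  factor \<open>s\<close>. The determinant \<open>b c - a d\<close> is multiplied by \<open>1 - x\<^sup>2\<close>, which cancels against \<open>s\<^sup>2\<close>.\<close>

lemma wave_casoratian: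
  assumes "\<bar>x\<bar> < 1"
  shows "(real n + 1 - real k) * (wave x (Suc n) k * wave x p k)
       - (real p + 1 - real k) * (wave x n k * wave x (Suc p) k)
     = (real n + real k + 3) * (wave x (Suc n) (Suc k) * wave x p (Suc k))
       - (real p + real k + 3) * (wave x n (Suc k) * wave x (Suc p) (Suc k))"
    (is "?l = ?r")
proof -
  define s where "s = sqrt (1 - x\<^sup>2)"
  have s: "s * s = 1 - x\<^sup>2" unfolding s_def by (rule sqrt_sq[OF assms])
  have "1 - x\<^sup>2 \<noteq> 0"
    using assms by (simp add: abs_square_less_1 less_imp_neq[symmetric] power2_eq_1_iff abs_if split: if_splits)
  note up = wave_raise[OF assms, folded s_def] and up' = wave_raise_Suc[OF assms, folded s_def]
  have "(1 - x\<^sup>2) * ?r = (s * (real n + real k + 3) * wave x (Suc n) (Suc k)) * (s * wave x p (Suc k))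
      - (s * wave x n (Suc k)) * (s * (real p + real k + 3) * wave x (Suc p) (Suc k))"
    unfolding s[symmetric] by (simp add: algebra_simps)
  also have "\<dots> = (1 - x\<^sup>2) * ?l"
    unfolding up up' by (simp add: algebra_simps power2_eq_square)
  finally show ?thesis using \<open>1 - x\<^sup>2 \<noteq> 0\<close> by simp
qed

section \<open>The telescoping sum\<close>

definition wave_sum :: "nat \<Rightarrow> real \<Rightarrow> nat \<Rightarrow> nat \<Rightarrow> real" where
  "wave_sum N x n m =
     (\<Sum>k\<le>m. (2 * real k + 1) * fact (N + k + 1) * fact (N - k) * (wave x n k * wave x m k))"

text \<open>Put \<open>X k = w(n,k) w(p+1,k)\<close> and \<open>Y k = w(n+1,k) w(p,k)\<close>. The summand is
  \<open>(N + k + 1)! (N - k)!\<close> times a linear polynomial in \<open>N\<close>. A telescoping antidifference of the form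
  \<open>V k = (N + k + 1)! (N + 1 - k)! * Z k\<close> with \<open>Z\<close> free of \<open>N\<close> must match both coefficients of that
  polynomial, which are two linear equations for \<open>Z k\<close> and \<open>Z (Suc k)\<close>. They have the solutions
  \<open>Z_def\<close> and \<open>ZS\<close> below, and that these agree is \<open>wave_casoratian\<close>.\<close>

lemma wave_sum_step:
  assumes "\<bar>x\<bar> < 1" "Suc p \<le> N" "Suc p \<le> n"
  shows "(real N - real p) * wave_sum N x n (Suc p) - (real N - real n) * wave_sum N x (Suc n) p
     = (fact (N + 1))\<^sup>2 / (fact (Suc p) * fact (Suc n)) * poly (chebyshev_U (n - Suc p)) x"
proof -
  define X Y where "X k = wave x n k * wave x (Suc p) k" and "Y k = wave x (Suc n) k * wave x p k" for k
  define Z where "Z k = (real n + real k + 2) * Y k - (real p + real k + 2) * X k" for k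
  define g :: "nat \<Rightarrow> real" where "g k = fact (N + k + 1) * fact (N - k)" for k
  define V where "V k = fact (N + k + 1) * fact (N + 1 - k) * Z k" for k
  have ZS: "Z (Suc k) = (real n + 1 - real k) * Y k - (real p + 1 - real k) * X k" for k
    using wave_casoratian[OF assms(1), of n k p] unfolding Z_def X_def Y_def
    by (simp add: algebra_simps)
  have tele: "(2 * real k + 1) * g k * ((real N - real p) * X k - (real N - real n) * Y k)
      = V (Suc k) - V k" if "k < Suc (Suc p)" for k
  proof -
    have k: "k \<le> N" using that assms(2) by simp
    have "fact (N + Suc k + 1) = (real N + real k + 2) * fact (N + k + 1)"
      by (simp add: algebra_simps)
    moreover have "fact (N + 1 - k) = (real N + 1 - real k) * fact (N - k)"
      using k by (simp add: Suc_diff_le of_nat_diff algebra_simps)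
    moreover have "N + 1 - Suc k = N - k" by simp
    ultimately have "V (Suc k) - V k =
        ((real N + real k + 2) * fact (N + k + 1)) * fact (N - k) * Z (Suc k)
          - fact (N + k + 1) * ((real N + 1 - real k) * fact (N - k)) * Z k"
      unfolding V_def by (simp only:)
    also have "\<dots> = g k * ((real N + real k + 2) * Z (Suc k) - (real N + 1 - real k) * Z k)"
      unfolding g_def by (simp add: algebra_simps del: fact_Suc)
    finally have "V (Suc k) - V k =
        g k * ((real N + real k + 2) * Z (Suc k) - (real N + 1 - real k) * Z k)" .
    then show ?thesis unfolding ZS by (simp add: Z_def algebra_simps)
  qed
  have Yp: "Y (Suc p) = 0" by (simp add: Y_def wave_eq_0)
  have "wave_sum N x n (Suc p) = (\<Sum>k<Suc (Suc p). (2 * real k + 1) * g k * X k)"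
    by (simp only: wave_sum_def g_def X_def lessThan_Suc_atMost mult.assoc)
  moreover have "wave_sum N x (Suc n) p = (\<Sum>k<Suc (Suc p). (2 * real k + 1) * g k * Y k)"
    using Yp by (simp add: wave_sum_def g_def Y_def lessThan_Suc_atMost mult.assoc del: fact_Suc)
  ultimately have "(real N - real p) * wave_sum N x n (Suc p) - (real N - real n) * wave_sum N x (Suc n) p
      = (\<Sum>k<Suc (Suc p). (2 * real k + 1) * g k * ((real N - real p) * X k - (real N - real n) * Y k))"
    by (simp only: sum_distrib_left sum_subtractf[symmetric]) (simp only: algebra_simps)
  also have "\<dots> = (\<Sum>k<Suc (Suc p). V (Suc k) - V k)"
    by (rule sum.cong) (use tele in simp_all)
  also have "\<dots> = V (Suc (Suc p)) - V 0"
    by (rule sum_lessThan_telescope)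
  also have "V (Suc (Suc p)) = 0"
    unfolding V_def ZS Yp by simp
  also have "0 - V 0 = (fact (N + 1))\<^sup>2 * ((real p + 2) * X 0 - (real n + 2) * Y 0)"
    unfolding V_def Z_def by (simp add: power2_eq_square algebra_simps)
  also have "(real p + 2) * X 0 = poly (chebyshev_U n) x * poly (chebyshev_U (Suc p)) x /
      (fact (Suc p) * fact (Suc n))"
    unfolding X_def wave_0[OF assms(1)] by (simp add: divide_simps)
  also have "(real n + 2) * Y 0 = poly (chebyshev_U (Suc n)) x * poly (chebyshev_U p) x /
      (fact (Suc p) * fact (Suc n))"
    unfolding Y_def wave_0[OF assms(1)] by (simp add: divide_simps)
  finally show ?thesis
    using chebyshev_U_diff[OF assms(1), of p n] assms(3) by (simp add: diff_divide_distrib[symmetric] del: fact_Suc)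
qed

section \<open>Expansion of the sum in Chebyshev polynomials\<close>

text \<open>Up to factorials, the coefficient depends on its last two arguments only through their sum:
  moving one unit from one to the other splits the first factor off each of the two rising
  factorials of length \<open>Suc p - t\<close>.\<close>

lemma weight_coeff_shift:
  assumes "2 * l = real N" "Suc p \<le> N" "t \<le> p"
  shows "(real N - real p) * weight_coeff l t (Suc p) n / (fact (Suc p) * fact n) =
    (real N - real n) * weight_coeff l t p (Suc n) / (fact p * fact (Suc n))"
proof -
  have tw: "twice l = N" using assms(1) by (simp add: twice_def)
  have d: "Suc p - t = Suc (p - t)" using assms(3) by simp
  have f: "fact (N - p) = (real N - real p) * fact (N - Suc p)"
    using assms(2) fact_reduce[of "N - p", where ?'a = real] by (simp add: of_nat_diff)
  define P Q q where "P = pochhammer (real n + 1 - real N) (p - t)"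
    and "Q = pochhammer (real n + 3) (p - t)" and "q = pochhammer (real N + 2 - real t) t"
  have P: "pochhammer (real n - real N) (Suc (p - t)) = (real n - real N) * P"
    unfolding P_def pochhammer_rec by (simp add: algebra_simps)
  have Q: "pochhammer (real n + 2) (Suc (p - t)) = (real n + 2) * Q"
    unfolding Q_def pochhammer_rec by (simp add: algebra_simps)
  have "Q \<noteq> 0" unfolding Q_def using pochhammer_pos[of "real n + 3" "p - t"] by simp
  moreover have e: "real (Suc n) + 2 = real n + 3" "real (Suc n) - real N = real n + 1 - real N" by simp_all
  ultimately show ?thesis
    unfolding weight_coeff_def tw assms(1) d P Q f e
      P_def[symmetric] Q_def[symmetric] q_def[symmetric]
    by (simp add: divide_simps; simp add: algebra_simps)
qed

text \<open>The one coefficient that the shift does not reach, \<open>t = Suc p\<close>, is the factor of the Chebyshev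
  polynomial in \<open>wave_sum_step\<close>.\<close>

lemma weight_coeff_diag:
  assumes "2 * l = real N" "Suc p \<le> N"
  shows "(real N - real p) * weight_coeff l (Suc p) (Suc p) n * (fact N)\<^sup>2 / (fact (Suc p) * fact n) =
    (fact (N + 1))\<^sup>2 / (fact (Suc p) * fact (Suc n))"
proof -
  have tw: "twice l = N" using assms(1) by (simp add: twice_def)
  have f: "fact (N - p) = (real N - real p) * fact (N - Suc p)"
    using assms(2) fact_reduce[of "N - p", where ?'a = real] by (simp add: of_nat_diff)
  have "fact (N + 1) = fact (N - p) * pochhammer (real N + 1 - real p) (Suc p)"
    using pochhammer_product'[of "1 :: real" "N - p" "Suc p"] assms(2)
    by (simp add: pochhammer_fact of_nat_diff algebra_simps)
  then have P: "pochhammer (real N + 1 - real p) (Suc p) = fact (N + 1) / fact (N - p)"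
    by simp
  have e: "real N + 2 - real (Suc p) = real N + 1 - real p" by simp
  have "real N - real p \<noteq> 0" using assms(2) by simp
  then show ?thesis
    unfolding weight_coeff_def tw assms(1) e P f
    by (simp add: divide_simps power2_eq_square; simp add: algebra_simps)
qed

text \<open>Since \<open>wave_sum_step\<close> and \<open>weight_coeff_shift\<close> hold also for \<open>n > N\<close>, the induction may let \<open>n\<close> grow
  beyond \<open>N\<close> while \<open>m\<close> decreases.\<close>

lemma wave_sum_eq_chebyshev_sum:
  assumes "\<bar>x\<bar> < 1" "2 * l = real N" "m \<le> N" "m \<le> n"
  shows "wave_sum N x n m = (fact N)\<^sup>2 / (fact m * fact n) *
    (\<Sum>t = 0..m. weight_coeff l t m n * poly (chebyshev_U (n + m - 2 * t)) x)"
  using assms(3,4)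
proof (induction m arbitrary: n)
  case 0
  have "twice l = N" using assms(2) by (simp add: twice_def)
  then show ?case
    using assms(1,2) gegenbauer_1_eq_chebyshev_U[of x 0]
    by (simp add: wave_sum_def wave_0 weight_coeff_def power2_eq_square divide_simps gegenbauer_0)
      (simp add: algebra_simps)
next
  case (Suc p)
  let ?U = "\<lambda>r. poly (chebyshev_U r) x"
  define c where "c = real N - real p"
  have "c \<noteq> 0" using Suc.prems(1) by (simp add: c_def)
  have "c * wave_sum N x n (Suc p) = (real N - real n) * wave_sum N x (Suc n) p
      + (fact (N + 1))\<^sup>2 / (fact (Suc p) * fact (Suc n)) * ?U (n - Suc p)"
    using wave_sum_step[OF assms(1) Suc.prems] unfolding c_def by linarith
  also have "wave_sum N x (Suc n) p = (fact N)\<^sup>2 / (fact p * fact (Suc n)) *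
      (\<Sum>t = 0..p. weight_coeff l t p (Suc n) * ?U (Suc n + p - 2 * t))"
    using Suc.prems by (intro Suc.IH) auto
  also have "(real N - real n) * \<dots> = (\<Sum>t = 0..p. (fact N)\<^sup>2 *
      ((real N - real n) * weight_coeff l t p (Suc n) / (fact p * fact (Suc n))) * ?U (n + Suc p - 2 * t))"
    by (simp add: sum_distrib_left mult_ac del: fact_Suc)
  also have "\<dots> = (\<Sum>t = 0..p. (fact N)\<^sup>2 *
      (c * weight_coeff l t (Suc p) n / (fact (Suc p) * fact n)) * ?U (n + Suc p - 2 * t))"
    using weight_coeff_shift[OF assms(2) Suc.prems(1)] unfolding c_def
    by (intro sum.cong) (simp_all del: fact_Suc)
  also have "(fact (N + 1))\<^sup>2 / (fact (Suc p) * fact (Suc n)) * ?U (n - Suc p) = (fact N)\<^sup>2 *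
      (c * weight_coeff l (Suc p) (Suc p) n / (fact (Suc p) * fact n)) * ?U (n + Suc p - 2 * Suc p)"
    unfolding weight_coeff_diag[OF assms(2) Suc.prems(1), symmetric] c_def
    by (simp del: fact_Suc)
  also have "(\<Sum>t = 0..p. (fact N)\<^sup>2 *
      (c * weight_coeff l t (Suc p) n / (fact (Suc p) * fact n)) * ?U (n + Suc p - 2 * t)) + \<dots>
    = c * ((fact N)\<^sup>2 / (fact (Suc p) * fact n) *
      (\<Sum>t = 0..Suc p. weight_coeff l t (Suc p) n * ?U (n + Suc p - 2 * t)))"
    by (simp add: sum_distrib_left algebra_simps del: fact_Suc)
  finally show ?case using \<open>c \<noteq> 0\<close> mult_left_cancel by blast
qed

section \<open>The LDU-decomposition\<close>

definition L_entry :: "real \<Rightarrow> nat \<Rightarrow> nat \<Rightarrow> real" where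
  "L_entry x m k = (if k > m then 0
     else fact m * fact (2 * k + 1) / (fact (m + k + 1) * fact k) * gegenbauer (real k + 1) (m - k) x)"

lemma L_entry_product:
  assumes "\<bar>x\<bar> < 1" "twice l = N"
  shows "L_entry x n k * (T_coeff l k * (1 - x\<^sup>2) ^ k) * L_entry x m k =
    fact n * fact m / (fact N)\<^sup>2 *
      ((2 * real k + 1) * fact (N + k + 1) * fact (N - k) * (wave x n k * wave x m k))"
proof (cases "k \<le> n \<and> k \<le> m")
  case True
  have "(2 * sqrt (1 - x\<^sup>2)) ^ k * (2 * sqrt (1 - x\<^sup>2)) ^ k = 4 ^ k * (1 - x\<^sup>2) ^ k"
    unfolding power_mult_distrib[symmetric] using sqrt_sq[OF assms(1)] by (simp add: mult_ac)
  then have w: "wave x n k * wave x m k = 4 ^ k * (1 - x\<^sup>2) ^ k * (fact k)\<^sup>2 /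
      (fact (n + k + 1) * fact (m + k + 1)) *
      (gegenbauer (real k + 1) (n - k) x * gegenbauer (real k + 1) (m - k) x)"
    using True by (simp add: wave_def power2_eq_square divide_simps mult_ac del: fact_Suc)
  show ?thesis
    unfolding w using True
    by (simp add: L_entry_def T_coeff_def assms(2) power2_eq_square power4_eq_xxxx mult_ac del: fact_Suc)
next
  case False
  then show ?thesis by (auto simp: L_entry_def wave_def)
qed

lemma weight_lower_eq_LTL:
  assumes "\<bar>x\<bar> < 1" "2 * l = real N" "m \<le> n" "n \<le> N"
  shows "weight_lower l x n m =
    sqrt (1 - x\<^sup>2) * (\<Sum>k<N + 1. L_entry x n k * (T_coeff l k * (1 - x\<^sup>2) ^ k) * L_entry x m k)"
proof -
  have tw: "twice l = N" using assms(2) by (simp add: twice_def)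
  have "(\<Sum>k<N + 1. L_entry x n k * (T_coeff l k * (1 - x\<^sup>2) ^ k) * L_entry x m k) =
      (\<Sum>k\<le>m. L_entry x n k * (T_coeff l k * (1 - x\<^sup>2) ^ k) * L_entry x m k)"
    using assms(3,4) by (intro sum.mono_neutral_right) (auto simp: L_entry_def)
  also have "\<dots> = fact n * fact m / (fact N)\<^sup>2 * wave_sum N x n m"
    by (simp only: L_entry_product[OF assms(1) tw] wave_sum_def sum_distrib_left)
  also have "\<dots> = (\<Sum>t = 0..m. weight_coeff l t m n * poly (chebyshev_U (n + m - 2 * t)) x)"
    using assms by (subst wave_sum_eq_chebyshev_sum[of x l N]) (simp_all add: divide_simps)
  finally show ?thesis by (simp add: weight_lower_def)
qed

lemma LTL_index:
  assumes "i \<le> twice l" "j \<le> twice l"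
  shows "(L_mat l x * T_mat l x * transpose_mat (L_mat l x)) $$ (i, j) = complex_of_real
    (\<Sum>k<twice l + 1. L_entry x i k * (T_coeff l k * (1 - x\<^sup>2) ^ k) * L_entry x j k)"
proof -
  have L: "L_mat l x = mat (twice l + 1) (twice l + 1) (\<lambda>(m, k). complex_of_real (L_entry x m k))"
    by (simp add: L_mat_def L_entry_def)
  have LT: "(L_mat l x * T_mat l x) $$ (i, k) =
      complex_of_real (L_entry x i k * (T_coeff l k * (1 - x\<^sup>2) ^ k))" if "k < twice l + 1" for k
    using that assms(1) unfolding L T_mat_def
    by (simp add: scalar_prod_def if_distrib[of complex_of_real] if_distrib[of "\<lambda>u. _ * u"]
        sum.delta del: sum.op_ivl_Suc cong: if_cong)
  have dim: "dim_row (L_mat l x) = twice l + 1" "dim_col (L_mat l x) = twice l + 1"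
    "dim_row (T_mat l x) = twice l + 1" "dim_col (T_mat l x) = twice l + 1"
    by (simp_all add: L_mat_def T_mat_def)
  have "(L_mat l x * T_mat l x * transpose_mat (L_mat l x)) $$ (i, j) =
      (\<Sum>k<twice l + 1. (L_mat l x * T_mat l x) $$ (i, k) * L_mat l x $$ (j, k))"
    using assms by (simp add: scalar_prod_def dim atLeast0LessThan)
  also have "\<dots> = (\<Sum>k<twice l + 1. complex_of_real
      (L_entry x i k * (T_coeff l k * (1 - x\<^sup>2) ^ k)) * complex_of_real (L_entry x j k))"
    using assms by (intro sum.cong) (simp_all only: LT lessThan_iff, simp add: L)
  finally show ?thesis by (simp only: of_real_sum of_real_mult)
qed

theorem theorem2p1:
  fixes l x :: real
  assumes "2 * l \<in> \<nat>"
    and "x \<in> {-1..1}"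
  shows "unipotent_lower_triangular (L_mat l x) \<and>
    diagonal_mat (T_mat l x) \<and>
    weight l x =
      complex_of_real (sqrt (1 - x\<^sup>2)) \<cdot>\<^sub>m (L_mat l x * T_mat l x * transpose_mat (L_mat l x))"
proof (intro conjI)
  obtain N where N: "2 * l = real N" using assms(1) by (auto elim: Nats_cases)
  then have tw: "twice l = N" by (simp add: twice_def)
  show "unipotent_lower_triangular (L_mat l x)"
    unfolding unipotent_lower_triangular_def
    by (auto simp: L_mat_def gegenbauer_0 mult_2 upper_triangular_def square_mat.simps simp del: fact_Suc)
  show "diagonal_mat (T_mat l x)"
    by (auto simp: diagonal_mat_def T_mat_def)
  show "weight l x =
      complex_of_real (sqrt (1 - x\<^sup>2)) \<cdot>\<^sub>m (L_mat l x * T_mat l x * transpose_mat (L_mat l x))"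
    (is "_ = ?R")
  proof (rule eq_matI)
    fix i j assume "i < dim_row ?R" "j < dim_col ?R"
    then have ij: "i \<le> N" "j \<le> N" by (simp_all add: L_mat_def tw)
    \<comment> \<open>The weight is defined by reflection above the diagonal, and \<open>S\<close> is symmetric.\<close>
    define S where "S n m = sqrt (1 - x\<^sup>2) *
      (\<Sum>k<N + 1. L_entry x n k * (T_coeff l k * (1 - x\<^sup>2) ^ k) * L_entry x m k)" for n m
    have S: "weight_lower l x n m = S n m" if "m \<le> n" "n \<le> N" for n m
    proof (cases "\<bar>x\<bar> < 1")
      case True
      then show ?thesis unfolding S_def by (rule weight_lower_eq_LTL[OF _ N that])
    next
      case False
      then have "x = 1 \<or> x = - 1" using assms(2) by auto
      then have "sqrt (1 - x\<^sup>2) = 0" by auto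
      then show ?thesis by (simp add: S_def weight_lower_def)
    qed
    have S_comm: "S i j = S j i" by (simp add: S_def mult_ac)
    have "?R $$ (i, j) = complex_of_real (S i j)"
      using ij LTL_index[of i l j x] by (simp add: S_def tw L_mat_def)
    moreover have "weight l x $$ (i, j) = complex_of_real (S i j)"
      using ij S[of j i] S[of i j] S_comm by (simp add: weight_def tw)
    ultimately show "weight l x $$ (i, j) = ?R $$ (i, j)" by simp
  qed (simp_all add: weight_def L_mat_def)
qed

end
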